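(* Let $\mathbb{F}$ be a field with characteristic $2$. Let $V$ be an infinite-dimensional vector space over $\mathbb{F}$, let $\alpha \in \{0_{\mathbb{F}},1_{\mathbb{F}}\}$, and let $u$ be a finite-rank endomorphism of $V$ whose trace belongs to $\{0_{\mathbb{F}},1_{\mathbb{F}}\}$. Then $\alpha\,\mathrm{id}_V+u$ is the sum of three idempotent endomorphisms of $V$.
   Context: An endomorphism $p$ of $V$ is idempotent if $p \circ p=p$. The trace of a finite-rank endomorphism $u$ of $V$ is the trace of the endomorphism of $W$ induced by $u$, where $W$ is any finite-dimensional linear subspace of $V$ containing the image of $u$ (this does not depend on the choice of $W$). *)

theory Defs
  imports "HOL-Computational_Algebra.Computational_Algebra"
begin

type_synonym ('f, 'v) scaling = "'f \<Rightarrow> 'v \<Rightarrow> 'v"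

definition finite_dim_subspace :: "('f::field, 'v::ab_group_add) scaling \<Rightarrow> 'v set \<Rightarrow> bool" where
  "finite_dim_subspace scale W \<longleftrightarrow>
     module.subspace scale W \<and> (\<exists>B. finite B \<and> W \<subseteq> module.span scale B)"

definition infinite_dimensional :: "('f::field, 'v::ab_group_add) scaling \<Rightarrow> bool" where
  "infinite_dimensional scale \<longleftrightarrow> \<not> finite_dim_subspace scale UNIV"

definition endomorphism :: "('f::field, 'v::ab_group_add) scaling \<Rightarrow> ('v \<Rightarrow> 'v) \<Rightarrow> bool" where
  "endomorphism scale f \<longleftrightarrow> Vector_Spaces.linear scale scale f"

definition idempotent_endomorphism :: "('f::field, 'v::ab_group_add) scaling \<Rightarrow> ('v \<Rightarrow> 'v) \<Rightarrow> bool" where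
  "idempotent_endomorphism scale p \<longleftrightarrow> endomorphism scale p \<and> p \<circ> p = p"

definition finite_rank_endomorphism :: "('f::field, 'v::ab_group_add) scaling \<Rightarrow> ('v \<Rightarrow> 'v) \<Rightarrow> bool" where
  "finite_rank_endomorphism scale u \<longleftrightarrow> endomorphism scale u \<and> finite_dim_subspace scale (range u)"

text \<open>
  The trace of the endomorphism that \<open>f\<close> induces on a finite-dimensional subspace \<open>W\<close> with
  \<open>f ` W \<subseteq> W\<close>: the sum of the diagonal entries of its matrix in some basis of \<open>W\<close>.
  Lemma \<open>trace_on_eq_basis\<close> shows that the basis does not matter.
\<close>

definition trace_on :: "('f::field, 'v::ab_group_add) scaling \<Rightarrow> 'v set \<Rightarrow> ('v \<Rightarrow> 'v) \<Rightarrow> 'f" where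
  "trace_on scale W f =
     (let B = (SOME B. \<not> module.dependent scale B \<and> module.span scale B = W)
      in \<Sum>b\<in>B. module.representation scale B (f b) b)"

text \<open>
  Lemma \<open>finite_rank_trace_eq\<close> shows that the choice of \<open>W\<close> does not matter.
\<close>

definition finite_rank_trace :: "('f::field, 'v::ab_group_add) scaling \<Rightarrow> ('v \<Rightarrow> 'v) \<Rightarrow> 'f" where
  "finite_rank_trace scale u =
     trace_on scale (SOME W. finite_dim_subspace scale W \<and> range u \<subseteq> W) u"

context vector_space
begin

lemma finite_basis:
  assumes "finite_dim_subspace scale W" "independent B" "span B = W"
  shows "finite B"
proof -
  obtain S where S: "finite S" "W \<subseteq> span S"
    using assms(1) unfolding finite_dim_subspace_def by blast
  have "B \<subseteq> span S" using S(2) assms(3) span_superset by blast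
  then show ?thesis using independent_span_bound[OF S(1) assms(2)] by simp
qed

lemma basis_of_subspace:
  assumes "subspace W"
  shows "\<exists>B. independent B \<and> span B = W"
  using assms by (metis maximal_independent_subset span_subspace)

lemma representation_sum_basis:
  assumes "independent B" "finite B" "v \<in> span B"
  shows "(\<Sum>b\<in>B. representation B v b *s b) = v"
  using assms by (intro sum_representation_eq) auto

lemma trace_basis_unique:
  assumes f: "endomorphism scale f"
    and B: "independent B" "finite B" "span B = W"
    and C: "independent C" "finite C" "span C = W"
    and W: "f ` W \<subseteq> W"
  shows "(\<Sum>b\<in>B. representation B (f b) b) = (\<Sum>c\<in>C. representation C (f c) c)"
proof -
  interpret f: Vector_Spaces.linear scale scale f using f unfolding endomorphism_def .
  have inW: "f b \<in> W" if "b \<in> W" for b using W that by blast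
  have BW: "B \<subseteq> W" and CW: "C \<subseteq> W" using B C span_superset by blast+
  have expand: "representation B v b = (\<Sum>c\<in>C. representation C v c * representation B c b)"
    if "v \<in> W" for v b
  proof -
    have "representation B v b = representation B (\<Sum>c\<in>C. representation C v c *s c) b"
      using representation_sum_basis[OF C(1,2)] C(3) that by simp
    also have "\<dots> = (\<Sum>c\<in>C. representation B (representation C v c *s c) b)"
      using CW B by (subst representation_sum) (auto intro: span_scale)
    also have "\<dots> = (\<Sum>c\<in>C. representation C v c * representation B c b)"
      using CW B by (intro sum.cong) (auto simp: representation_scale)
    finally show ?thesis .
  qed
  have coeff: "(\<Sum>b\<in>B. representation B c b * representation C (f b) c) = representation C (f c) c"
    if "c \<in> C" for c
  proof -
    have "f c = f (\<Sum>b\<in>B. representation B c b *s b)"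
      using representation_sum_basis[OF B(1,2)] B(3) CW that by auto
    also have "\<dots> = (\<Sum>b\<in>B. representation B c b *s f b)"
      by (simp add: f.sum f.scale)
    finally have "representation C (f c) c = representation C (\<Sum>b\<in>B. representation B c b *s f b) c"
      by simp
    also have "\<dots> = (\<Sum>b\<in>B. representation C (representation B c b *s f b) c)"
      using BW C inW by (subst representation_sum) (auto intro!: span_scale)
    also have "\<dots> = (\<Sum>b\<in>B. representation B c b * representation C (f b) c)"
      using BW C inW by (intro sum.cong refl) (simp add: representation_scale subset_iff)
    finally show ?thesis by simp
  qed
  have "(\<Sum>b\<in>B. representation B (f b) b)
      = (\<Sum>b\<in>B. \<Sum>c\<in>C. representation C (f b) c * representation B c b)"
    using BW inW by (intro sum.cong refl expand) auto
  also have "\<dots> = (\<Sum>c\<in>C. \<Sum>b\<in>B. representation B c b * representation C (f b) c)"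
    by (subst sum.swap) (simp add: mult.commute)
  also have "\<dots> = (\<Sum>c\<in>C. representation C (f c) c)"
    by (intro sum.cong refl coeff)
  finally show ?thesis .
qed

lemma trace_on_eq_basis:
  assumes "endomorphism scale f" "finite_dim_subspace scale W" "f ` W \<subseteq> W" "independent B" "span B = W"
  shows "trace_on scale W f = (\<Sum>b\<in>B. representation B (f b) b)"
proof -
  define C where "C = (SOME B. independent B \<and> span B = W)"
  have C: "independent C \<and> span C = W"
    unfolding C_def by (rule someI[of _ B]) (use assms in simp)
  have "trace_on scale W f = (\<Sum>c\<in>C. representation C (f c) c)"
    by (simp add: trace_on_def C_def Let_def)
  also have "\<dots> = (\<Sum>b\<in>B. representation B (f b) b)"
    using assms C finite_basis by (intro trace_basis_unique[where W = W]) auto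
  finally show ?thesis .
qed

lemma trace_on_eq_range:
  assumes u: "finite_rank_endomorphism scale u" and W: "finite_dim_subspace scale W" "range u \<subseteq> W"
  shows "trace_on scale W u = trace_on scale (range u) u"
proof -
  have e: "endomorphism scale u" and r: "finite_dim_subspace scale (range u)"
    using u unfolding finite_rank_endomorphism_def by auto
  obtain A where A: "independent A" "span A = range u"
    using basis_of_subspace r unfolding finite_dim_subspace_def by blast
  have AW: "A \<subseteq> W" using A W(2) span_superset by blast
  obtain B where B: "A \<subseteq> B" "B \<subseteq> W" "independent B" "W \<subseteq> span B"
    using maximal_independent_subset_extend[OF AW A(1)] by blast
  have sB: "span B = W"
    using B W(1) unfolding finite_dim_subspace_def by (metis span_subspace)
  have fB: "finite B" using finite_basis[OF W(1) B(3) sB] .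
  have rep: "representation B (u b) = representation A (u b)" for b
    using A B by (intro representation_extend) auto
  have "trace_on scale W u = (\<Sum>b\<in>B. representation B (u b) b)"
    using W by (intro trace_on_eq_basis e B(3) sB) auto
  also have "\<dots> = (\<Sum>b\<in>A. representation A (u b) b)"
    using fB B(1) by (intro sum.mono_neutral_cong_right) (auto simp: rep dest: representation_ne_zero)
  also have "\<dots> = trace_on scale (range u) u"
    by (intro trace_on_eq_basis[symmetric] e r A) auto
  finally show ?thesis .
qed

lemma finite_rank_trace_eq:
  assumes "finite_rank_endomorphism scale u" "finite_dim_subspace scale W" "range u \<subseteq> W"
  shows "finite_rank_trace scale u = trace_on scale W u"
proof -
  define W' where "W' = (SOME W. finite_dim_subspace scale W \<and> range u \<subseteq> W)"
  have "finite_dim_subspace scale W' \<and> range u \<subseteq> W'"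
    unfolding W'_def by (rule someI[of _ W]) (use assms in simp)
  then show ?thesis
    using trace_on_eq_range[OF assms(1)] assms(2,3) unfolding finite_rank_trace_def W'_def by simp
qed

end

end

theory Submission
  imports Defs
begin

text \<open>
  In characteristic 2 the map \<open>id + p\<close> is idempotent whenever \<open>p\<close> is, so \<open>id + u\<close> is a sum of
  three idempotents as soon as \<open>u\<close> is; the case \<open>\<alpha> = 0\<close> is therefore the whole problem.

  Two facts provide sums of two idempotents. If \<open>P\<close> is idempotent and \<open>P N + N P = N\<close>, that is, if
  \<open>N\<close> is odd for the grading of \<open>V\<close> by the kernel and the image of \<open>P\<close>, then
  \<open>N = (P + N P) + (P + P N)\<close> and both summands are idempotent (\<open>sum_of_two_idempotents\<close>).
  Every nilpotent map is odd for a suitable grading (\<open>nilpotent_grading\<close>), and hence every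
  \<open>B\<close> with \<open>B\<^sup>m\<^sup>+\<^sup>1 = B\<^sup>m\<close>, which is nilpotent on one summand of \<open>V\<close> and the identity on a
  complement, is a sum of two idempotents (\<open>stable_powers_sum_of_two_idempotents\<close>).

  It remains to find an idempotent \<open>R\<close> such that \<open>B = u + R\<close> is of one of these kinds. Let \<open>I\<close> be
  the range of \<open>u\<close>. As the kernel of \<open>u\<close> is infinite-dimensional, it has a complement that meets
  \<open>I\<close> only in 0; let \<open>g : I \<rightarrow> V\<close> be the inverse of \<open>u\<close> with values in that complement
  (\<open>generic_section\<close>). For every endomorphism \<open>n\<close> of \<open>I\<close> there is an idempotent \<open>R\<close>
  that kills \<open>g(I)\<close> and a subspace of the kernel of \<open>u\<close> complementary to \<open>I + g(I)\<close>, and sends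
  \<open>c \<in> I\<close> to \<open>c + g (n c)\<close>. With \<open>T = u + id\<close> on \<open>I\<close>, the map \<open>B = u + R\<close> then satisfies
  \<open>B (g d) = d\<close> and \<open>B c = T c + g (n c)\<close>: it is the block companion map of the quadratic
  polynomial \<open>X\<^sup>2 + T X + n\<close> with coefficients in the endomorphism ring of \<open>I\<close>, where \<open>T\<close> is
  given and \<open>n\<close> can be chosen at will.

  If \<open>T = U + L\<close>, the choice \<open>n = U L\<close> makes \<open>B\<close> block triangular with diagonal blocks \<open>L\<close> and \<open>U\<close>,
  like a polynomial that factors as \<open>(X + U) (X + L)\<close>. So it suffices that \<open>U\<close> is nilpotent and the
  powers of \<open>L\<close> stabilise. The trace of \<open>T\<close> is the trace of \<open>u\<close> plus the rank of \<open>u\<close>, which lies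
  in \<open>{0, 1}\<close>; so unless \<open>T\<close> is scalar, it has a matrix with zero diagonal except perhaps for an
  identity block at the lower end, and \<open>U\<close> and \<open>L\<close> are its strictly upper and its lower
  triangular part (\<open>splits_on_of_trace\<close>). A scalar \<open>T\<close> with factor 0 or 1 splits trivially. If \<open>T\<close> is scalar
  with another factor, the trace condition makes the rank of \<open>u\<close> even. Then \<open>n\<close> is taken with
  square 0 and with kernel equal to its image, and an explicit grading makes \<open>B\<close> odd
  (\<open>sum_of_three_idempotents_if_scalar\<close>).
\<close>

section \<open>Endomorphisms and bases\<close>

text \<open>
  A basis-free form of the decomposition of a matrix, with zero diagonal except perhaps for an
  identity block at the lower end, into its strictly upper triangular part \<open>U\<close> and its lower
  triangular part \<open>L\<close>. The condition on the powers of \<open>L\<close> means that \<open>W\<close> is the direct sum of a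
  subspace on which \<open>L\<close> is nilpotent and one on which \<open>L\<close> is the identity.
\<close>

definition splits_on :: "('f::field, 'v::ab_group_add) scaling \<Rightarrow> 'v set \<Rightarrow> ('v \<Rightarrow> 'v) \<Rightarrow> bool" where
  "splits_on scale W T \<longleftrightarrow> (\<exists>U L m. endomorphism scale U \<and> endomorphism scale L
     \<and> U ` W \<subseteq> W \<and> L ` W \<subseteq> W
     \<and> (\<forall>x\<in>W. T x = U x + L x \<and> (U ^^ m) x = 0 \<and> (L ^^ Suc m) x = (L ^^ m) x))"

context vector_space
begin

interpretation self: vector_space_pair scale scale
  by unfold_locales

lemma endomorphism_iff:
  "endomorphism scale f \<longleftrightarrow> (\<forall>x y. f (x + y) = f x + f y) \<and> (\<forall>c x. f (c *s x) = c *s f x)"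
  unfolding endomorphism_def Vector_Spaces.linear_def module_hom_iff
  using vector_space_axioms module_axioms by auto

lemma endo_add: "endomorphism scale f \<Longrightarrow> f (x + y) = f x + f y"
  and endo_scale: "endomorphism scale f \<Longrightarrow> f (c *s x) = c *s f x"
  by (simp_all add: endomorphism_iff)

lemma endo_0: "endomorphism scale f \<Longrightarrow> f 0 = 0"
  using endo_scale[of f 0 0] by simp

lemma endo_diff: "endomorphism scale f \<Longrightarrow> f (x - y) = f x - f y"
  using endo_add[of f "x - y" y] by (simp add: algebra_simps)

lemma endo_sum: "endomorphism scale f \<Longrightarrow> f (\<Sum>i\<in>A. g i) = (\<Sum>i\<in>A. f (g i))"
  by (induction A rule: infinite_finite_induct) (auto simp: endo_0 endo_add)

lemma endo_ident: "endomorphism scale (\<lambda>x. x)"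
  by (simp add: endomorphism_iff)

lemma endo_zero: "endomorphism scale (\<lambda>x. 0)"
  by (simp add: endomorphism_iff)

lemma endo_mult: "endomorphism scale (\<lambda>x. c *s x)"
  by (simp add: endomorphism_iff scale_right_distrib mult.commute)

lemma endo_comp:
  "endomorphism scale f \<Longrightarrow> endomorphism scale g \<Longrightarrow> endomorphism scale (\<lambda>x. f (g x))"
  by (simp add: endomorphism_iff)

lemma endo_plus:
  "endomorphism scale f \<Longrightarrow> endomorphism scale g \<Longrightarrow> endomorphism scale (\<lambda>x. f x + g x)"
  by (simp add: endomorphism_iff scale_right_distrib algebra_simps)

lemma endo_minus:
  "endomorphism scale f \<Longrightarrow> endomorphism scale g \<Longrightarrow> endomorphism scale (\<lambda>x. f x - g x)"
  by (simp add: endomorphism_iff scale_right_diff_distrib algebra_simps)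

lemma endo_funpow: "endomorphism scale f \<Longrightarrow> endomorphism scale (f ^^ m)"
  by (induction m) (auto simp: endomorphism_iff)

lemma endo_eq_on_span:
  assumes "endomorphism scale f" "endomorphism scale g" "\<And>b. b \<in> B \<Longrightarrow> f b = g b" "x \<in> span B"
  shows "f x = g x"
  using assms(4)
  by (induction rule: span_induct_alt) (use assms in \<open>auto simp: endo_0 endo_add endo_scale\<close>)

lemma endo_maps_span:
  assumes "endomorphism scale f" "subspace S" "\<And>b. b \<in> B \<Longrightarrow> f b \<in> S" "x \<in> span B"
  shows "f x \<in> S"
  using assms(4)
  by (induction rule: span_induct_alt)
    (use assms in \<open>auto simp: endo_0 endo_add endo_scale subspace_0 subspace_add subspace_scale\<close>)

lemma endo_extend:
  assumes "independent B"
  shows "\<exists>g. endomorphism scale g \<and> (\<forall>b\<in>B. g b = f b)"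
  using self.linear_independent_extend[OF assms] unfolding endomorphism_def by blast

lemma extend_to_basis:
  assumes "independent A" "A \<subseteq> W" "subspace W"
  shows "\<exists>B. A \<subseteq> B \<and> independent B \<and> span B = W"
  using maximal_independent_subset_extend[OF assms(2,1)] assms(3) by (metis span_subspace)

text \<open>
  Two basis vectors and their sum are eigenvectors only if all three eigenvalues agree.
\<close>

lemma scalar_if_all_eigenvectors:
  assumes T: "endomorphism scale T"
    and eig: "\<And>x. x \<in> span B \<Longrightarrow> \<exists>c. T x = c *s x" and B: "independent B"
  shows "\<exists>c. \<forall>x\<in>span B. T x = c *s x"
proof -
  have "\<exists>c. \<forall>b\<in>B. T b = c *s b"
  proof (cases "B = {}")
    case False
    then obtain b0 where b0: "b0 \<in> B" by blast
    obtain c where c: "T b0 = c *s b0" using eig b0 span_base by blast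
    have "T b = c *s b" if b: "b \<in> B" for b
    proof (cases "b = b0")
      case False
      obtain d where d: "T b = d *s b" using eig b span_base by blast
      obtain k where "T (b0 + b) = k *s (b0 + b)" using eig b b0 span_base span_add by meson
      then have k: "(k - c) *s b0 + (k - d) *s b = 0"
        by (simp add: endo_add[OF T] c d algebra_simps)
      have "independent {b0, b}" using independent_mono[OF B] b b0 by simp
      then have "(if x = b0 then k - c else k - d) = 0" if "x \<in> {b0, b}" for x
        by (rule independentD[of "{b0,b}" "{b0,b}" "\<lambda>x. if x = b0 then k - c else k - d"])
          (use k False that in auto)
      from this[of b0] this[of b] False have "c = d" by auto
      then show ?thesis using d by simp
    qed (use c in simp)
    then show ?thesis by blast
  qed simp
  then obtain c where c: "\<forall>b\<in>B. T b = c *s b" by blast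
  then have "\<forall>x\<in>span B. T x = c *s x"
    using endo_eq_on_span[OF T endo_mult] by blast
  then show ?thesis by blast
qed

section \<open>Splitting an endomorphism with prescribed trace\<close>

text \<open>
  In this section, \<open>P\<close> is the projection along \<open>v\<close> onto the span of the other vectors
  of \<open>C\<close>, so that \<open>P \<circ> T\<close> is the compression of \<open>T\<close> to that span: its matrix is the matrix of
  \<open>T\<close> without the row and the column of \<open>v\<close>.
\<close>

lemma compression_in_span:
  assumes "endomorphism scale P" "P v = 0" "\<And>d. d \<in> C - {v} \<Longrightarrow> P d = d" "x \<in> span C"
  shows "P x \<in> span (C - {v})"
proof -
  have "P b \<in> span (C - {v})" if "b \<in> C" for b
    using that assms(2,3) by (cases "b = v") (auto simp: span_zero span_base)
  then show ?thesis using endo_maps_span[OF assms(1) subspace_span] assms(4) by blast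
qed

lemma representation_projection:
  assumes C: "independent C" "finite C" and v: "v \<in> C"
    and P: "endomorphism scale P" "P v = 0" "\<And>d. d \<in> C - {v} \<Longrightarrow> P d = d"
    and y: "y \<in> span C" and d: "d \<in> C - {v}"
  shows "representation (C - {v}) (P y) d = representation C y d"
proof -
  let ?D = "C - {v}"
  have D: "independent ?D" using C independent_mono by blast
  have "P y = P (\<Sum>c\<in>C. representation C y c *s c)"
    using representation_sum_basis[OF C y] by simp
  also have "\<dots> = (\<Sum>c\<in>C. representation C y c *s P c)"
    by (simp add: endo_sum[OF P(1)] endo_scale[OF P(1)])
  also have "\<dots> = (\<Sum>c\<in>?D. representation C y c *s c)"
    using C(2) v P by (simp add: sum.remove[of C v])
  finally have "representation ?D (P y) d = (\<Sum>c\<in>?D. representation ?D (representation C y c *s c) d)"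
    using D by (simp only:, subst representation_sum) (auto intro: span_base span_scale)
  also have "\<dots> = (\<Sum>c\<in>?D. if c = d then representation C y c else 0)"
    using D by (intro sum.cong) (auto simp: representation_scale span_base representation_basis)
  also have "\<dots> = representation C y d"
    using C(2) d by simp
  finally show ?thesis .
qed


lemma splits_onI:
  assumes "endomorphism scale U" "endomorphism scale L"
    and "\<And>x. x \<in> W \<Longrightarrow> U x \<in> W" "\<And>x. x \<in> W \<Longrightarrow> L x \<in> W" "\<And>x. x \<in> W \<Longrightarrow> T x = U x + L x"
    and "\<And>x. x \<in> W \<Longrightarrow> (U ^^ m) x = 0" "\<And>x. x \<in> W \<Longrightarrow> (L ^^ Suc m) x = (L ^^ m) x"
  shows "splits_on scale W T"
  unfolding splits_on_def using assms
  by (intro exI[of _ U] exI[of _ L] exI[of _ m] conjI ballI image_subsetI)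

text \<open>
  The column of \<open>v\<close> has its only entry in the row of \<open>T v\<close>, off the diagonal, and goes to \<open>L\<close>;
  the row of \<open>v\<close> goes to \<open>U\<close>. Extending a splitting of the compression in this way raises the
  exponents by one because \<open>U\<close> leads from the span of the other vectors to \<open>v\<close> but kills \<open>v\<close>,
  while \<open>L\<close> leads from \<open>v\<close> to the others but never back.
\<close>

lemma splits_on_step:
  assumes T: "endomorphism scale T" "T ` span C \<subseteq> span C"
    and v: "v \<in> C" "T v \<in> C" "T v \<noteq> v"
    and P: "endomorphism scale P" "P v = 0" "\<And>d. d \<in> C - {v} \<Longrightarrow> P d = d"
    and H: "splits_on scale (span (C - {v})) (P \<circ> T)"
  shows "splits_on scale (span C) T"
proof -
  let ?H = "span (C - {v})"
  have HC: "?H \<subseteq> span C" by (intro span_mono) auto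
  have Pid: "P x = x" if "x \<in> ?H" for x
    using endo_eq_on_span[OF P(1) endo_ident P(3) that] .
  have PH: "P x \<in> ?H" if "x \<in> span C" for x
    using compression_in_span[OF P that] .
  obtain U L m where U: "endomorphism scale U" "U ` ?H \<subseteq> ?H" and L: "endomorphism scale L" "L ` ?H \<subseteq> ?H"
    and ULm: "\<forall>x\<in>?H. (P \<circ> T) x = U x + L x \<and> (U ^^ m) x = 0 \<and> (L ^^ Suc m) x = (L ^^ m) x"
    using H unfolding splits_on_def by blast
  have s: "P (T x) = U x + L x" and Um: "(U ^^ m) x = 0" and Lm: "(L ^^ Suc m) x = (L ^^ m) x"
    if "x \<in> ?H" for x using ULm that unfolding o_apply by blast+
  define U' where "U' x = U (P x) + (T (P x) - P (T (P x)))" for x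
  define L' where "L' x = L (P x) + (T x - T (P x))" for x
  have PS: "P x \<in> span C" if "x \<in> span C" for x using PH HC that by blast
  have TS: "T x \<in> span C" if "x \<in> span C" for x using T(2) that by blast
  have U': "endomorphism scale U'" and L': "endomorphism scale L'"
    unfolding U'_def L'_def
    by (rule endo_plus endo_minus endo_comp[OF U(1) P(1)] endo_comp[OF L(1) P(1)] T(1)
        endo_comp[OF T(1) P(1)] endo_comp[OF P(1) endo_comp[OF T(1) P(1)]])+
  have kerP: "T (x - P x) \<in> ?H" if "x \<in> span C" for x
  proof -
    have e: "endomorphism scale (\<lambda>x. T (x - P x))"
      using endo_comp[OF T(1) endo_minus[OF endo_ident P(1)]] .
    have "T (d - P d) \<in> ?H" if "d \<in> C" for d
      using that P(2,3) v endo_0[OF T(1)] by (cases "d = v") (auto simp: span_zero span_base)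
    then show ?thesis using endo_maps_span[OF e subspace_span _ that] by blast
  qed
  have U'S: "U' x \<in> span C" if "x \<in> span C" for x
  proof -
    have "U (P x) \<in> span C" using PH[OF that] U(2) HC by blast
    moreover have "T (P x) \<in> span C" using PS TS that by blast
    ultimately show ?thesis unfolding U'_def using PS by (intro span_add span_diff) blast+
  qed
  have L'H: "L' x \<in> ?H" if "x \<in> span C" for x
  proof -
    have "L (P x) \<in> ?H" using PH[OF that] L(2) by blast
    then show ?thesis
      unfolding L'_def using span_add[OF _ kerP[OF that]] by (simp add: endo_diff[OF T(1)])
  qed
  have PU': "P (U' x) = U (P x)" if "x \<in> span C" for x
  proof -
    have "P (U (P x)) = U (P x)" using PH[OF that] U(2) Pid by blast
    moreover have "P (P (T (P x))) = P (T (P x))" using Pid PH TS PS that by blast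
    ultimately show ?thesis by (simp add: U'_def endo_add[OF P(1)] endo_diff[OF P(1)])
  qed
  have U'pow: "(U' ^^ i) x \<in> span C \<and> P ((U' ^^ i) x) = (U ^^ i) (P x)" if "x \<in> span C" for x i
    by (induction i) (simp_all add: that U'S PU')
  have U'm: "(U' ^^ Suc m) x = 0" if "x \<in> span C" for x
    using U'pow[OF that, of m] Um[OF PH[OF that]]
    by (simp add: U'_def endo_0[OF U(1)] endo_0[OF T(1)] endo_0[OF P(1)])
  have L'pow: "(L' ^^ i) x = (L ^^ i) x \<and> (L ^^ i) x \<in> ?H" if "x \<in> ?H" for x i
  proof (induction i)
    case (Suc i)
    have "L ((L ^^ i) x) \<in> ?H" using Suc L(2) by blast
    then show ?case using Suc Pid by (simp add: L'_def)
  qed (use that in simp)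
  have L'm: "(L' ^^ Suc (Suc m)) x = (L' ^^ Suc m) x" if "x \<in> span C" for x
    using L'pow[OF L'H[OF that], of m] L'pow[OF L'H[OF that], of "Suc m"] Lm[OF L'H[OF that]]
    by (metis funpow_Suc_right o_apply)
  have "T x = U' x + L' x" if "x \<in> span C" for x
    using s[OF PH[OF that]] by (simp add: U'_def L'_def)
  then show ?thesis
    using U' L' U'S L'H HC U'm L'm by (intro splits_onI[of U' L' _ _ "Suc m"]) blast+
qed

lemma trace_scalar:
  assumes B: "independent B" and T: "\<And>b. b \<in> B \<Longrightarrow> T b = c *s b"
  shows "(\<Sum>b\<in>B. representation B (T b) b) = of_nat (card B) * c"
proof -
  have "representation B (T b) b = c" if "b \<in> B" for b
    using B T[OF that] that by (simp add: representation_scale span_base representation_basis)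
  then show ?thesis by simp
qed

text \<open>
  Fillmore's inductive construction of a basis in which the diagonal of a nonscalar map is
  prescribed. A non-eigenvector \<open>v\<close> and its image \<open>T v\<close> start a basis, the diagonal entry at \<open>v\<close>
  is 0, and the induction goes on with the compression to the span of the other basis vectors,
  until the compression is zero or the identity. If that compression is a scalar other
  than 0 and 1, then by the trace condition there is a third basis vector \<open>x\<close>, and replacing it
  by \<open>x + v\<close> adds the vector \<open>T v\<close> to the image of the third one, which destroys scalarity.

  On a nonzero space a scalar map with factor \<open>c \<notin> {0, 1}\<close> never splits, because \<open>L = c id - U\<close> with
  \<open>U\<close> nilpotent has the eigenvalue \<open>c\<close>.
\<close>

theorem splits_on_of_trace:
  assumes "finite B" "independent B" and T: "endomorphism scale T" "T ` span B \<subseteq> span B"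
    and "(\<Sum>b\<in>B. representation B (T b) b) \<in> {0, 1}"
    and "\<And>c. (\<forall>x\<in>span B. T x = c *s x) \<Longrightarrow> c \<in> {0, 1} \<or> B = {}"
  shows "splits_on scale (span B) T"
  using assms
proof (induction "card B" arbitrary: B T rule: less_induct)
  case less
  note T = less.prems(3,4)
  show ?case
  proof (cases "\<exists>c. \<forall>x\<in>span B. T x = c *s x")
    case True
    have "\<exists>c\<in>{0,1}. \<forall>x\<in>span B. T x = c *s x"
    proof (cases "B = {}")
      case True
      then show ?thesis using endo_0[OF T(1)] by auto
    next
      case False
      then show ?thesis using \<open>\<exists>c. \<forall>x\<in>span B. T x = c *s x\<close> less.prems(6) by blast
    qed
    then obtain c where c: "c \<in> {0, 1}" "\<forall>x\<in>span B. T x = c *s x" by blast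
    have "(T ^^ Suc 1) x = (T ^^ 1) x" if "x \<in> span B" for x
      using c that endo_0[OF T(1)] by auto
    moreover have "T x \<in> span B" if "x \<in> span B" for x using T(2) that by blast
    ultimately show ?thesis
      using endo_zero T(1) by (intro splits_onI[of "\<lambda>x. 0" T _ _ 1]) (simp_all add: span_zero)
  next
    case nonscalar: False
    then obtain v where v: "v \<in> span B" "\<And>c. T v \<noteq> c *s v"
      using scalar_if_all_eigenvectors[OF T(1) _ less.prems(2)] by blast
    define w where "w = T v"
    have w: "w \<in> span B" using v T unfolding w_def by blast
    have "v \<noteq> 0" using v(2)[of 0] endo_0[OF T(1)] by auto
    have "w \<notin> span {v}" using v(2) unfolding w_def by (auto simp: span_singleton)
    moreover have "independent {v}" using \<open>v \<noteq> 0\<close> dependent_single by blast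
    ultimately have vw: "independent {w, v}" "w \<noteq> v"
      using independent_insertI[of w "{v}"] span_base[of v "{v}"] by auto
    have basis: "finite C \<and> card C = card B
        \<and> (\<Sum>c\<in>C. representation C (T c) c) = (\<Sum>b\<in>B. representation B (T b) b)"
      if C: "independent C" "span C = span B" for C
    proof -
      have "finite_dim_subspace scale (span B)"
        unfolding finite_dim_subspace_def using less.prems(1) by auto
      then have f: "finite C" using finite_basis C by blast
      then show ?thesis
        using C less.prems(1,2) T
          dim_eq_card[OF C(2) C(1)] dim_eq_card[OF refl less.prems(2)]
          trace_basis_unique[OF T(1) C(1) f C(2) less.prems(2,1) refl T(2)] by simp
    qed
    \<comment> \<open>The entry of \<open>T v = w\<close> at \<open>v\<close> is 0, so the compression has the same trace as \<open>T\<close>.\<close>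
    have reduce: "splits_on scale (span B) T"
      if C: "independent C" "span C = span B" "v \<in> C" "w \<in> C"
        and P: "endomorphism scale P" "P v = 0" "\<And>d. d \<in> C - {v} \<Longrightarrow> P d = d"
        and good: "\<And>c. (\<forall>x\<in>span (C - {v}). P (T x) = c *s x) \<Longrightarrow> c \<in> {0, 1} \<or> C - {v} = {}"
      for C P
    proof -
      have f: "finite C" "card C = card B" using basis C by auto
      have D: "independent (C - {v})" using C(1) independent_mono by blast
      have TC: "T c \<in> span C" if "c \<in> C" for c using that T C(2) span_base by blast
      have PC: "P x \<in> span (C - {v})" if "x \<in> span C" for x
        using compression_in_span[OF P that] .
      have PT: "endomorphism scale (P \<circ> T)"
        using P(1) T(1) by (auto simp: endomorphism_iff)
      have inv: "(P \<circ> T) ` span (C - {v}) \<subseteq> span (C - {v})"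
      proof clarsimp
        fix x assume "x \<in> span (C - {v})"
        then have "x \<in> span C" using span_mono[of "C - {v}" C] by blast
        then show "P (T x) \<in> span (C - {v})" using PC T(2) C(2) by blast
      qed
      have "(\<Sum>d\<in>C - {v}. representation (C - {v}) ((P \<circ> T) d) d) = (\<Sum>d\<in>C - {v}. representation C (T d) d)"
        by (intro sum.cong refl) (use representation_projection[OF C(1) f(1) C(3) P] TC in auto)
      also have "\<dots> = (\<Sum>c\<in>C. representation C (T c) c)"
        using f C vw(2) by (simp add: sum.remove[of C v] flip: w_def) (simp add: representation_basis)
      also have "\<dots> \<in> {0, 1}" using basis C less.prems(5) by simp
      finally have tr: "(\<Sum>d\<in>C - {v}. representation (C - {v}) ((P \<circ> T) d) d) \<in> {0, 1}" .
      have "card (C - {v}) < card B" using f C(3) by (metis card_Diff1_less)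
      then have H: "splits_on scale (span (C - {v})) (P \<circ> T)"
        using less.hyps[of "C - {v}" "P \<circ> T"] f D PT inv tr good by auto
      have "T ` span C \<subseteq> span C" using T(2) C(2) by simp
      moreover have "T v \<in> C" "T v \<noteq> v" using C(4) vw(2) by (simp_all add: w_def)
      ultimately have "splits_on scale (span C) T"
        using splits_on_step[OF T(1) _ C(3) _ _ P H] by blast
      then show ?thesis using C(2) by simp
    qed
    have compression: "\<exists>P. endomorphism scale P \<and> P v = 0 \<and> (\<forall>d\<in>C - {v}. P d = d)"
      if CI: "independent C" "v \<in> C" for C
    proof -
      obtain g where g: "endomorphism scale g" "\<forall>c\<in>C. g c = (if c = v then 0 else c)"
        using endo_extend[OF CI(1), of "\<lambda>c. if c = v then 0 else c"] by blast
      then have "g v = 0" "\<forall>d\<in>C - {v}. g d = d" using CI(2) by simp_all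
      then show ?thesis using g(1) by blast
    qed
    obtain C where C: "{w, v} \<subseteq> C" "independent C" "span C = span B"
      using extend_to_basis[OF vw(1), of "span B"] v(1) w by auto
    obtain P where P: "endomorphism scale P" "P v = 0" "\<forall>d\<in>C - {v}. P d = d"
      using compression C by blast
    show ?thesis
    proof (cases "\<forall>c. (\<forall>x\<in>span (C - {v}). P (T x) = c *s x) \<longrightarrow> c \<in> {0, 1}")
      case True
      then show ?thesis using C(1) P(3) by (intro reduce[OF C(2,3) _ _ P(1,2)]) blast+
    next
      case False
      then obtain c where c: "\<forall>x\<in>span (C - {v}). P (T x) = c *s x" "c \<notin> {0, 1}" by blast
      \<comment> \<open>In dimension 2 the factor \<open>c\<close> of the compression would be the trace.\<close>
      have "C - {v} \<noteq> {w}"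
      proof
        assume Cw: "C - {v} = {w}"
        then have C2: "C = {w, v}" using C(1) by blast
        have Tw: "T w \<in> span C" using w T(2) C(3) by blast
        have "representation (C - {v}) (P (T w)) w = representation C (T w) w"
          by (rule representation_projection[OF C(2) _ _ P(1,2) _ Tw]) (use C(1) P(3) vw(2) C2 in auto)
        moreover have "representation (C - {v}) (P (T w)) w = c"
        proof -
          have "independent {w}" by (rule independent_mono[OF vw(1)]) simp
          moreover have "P (T w) = c *s w" using c(1) Cw span_base[of w "{w}"] by simp
          ultimately show ?thesis
            unfolding Cw by (simp add: representation_scale span_base representation_basis)
        qed
        moreover have "representation C (T v) v = 0"
          using representation_basis[OF C(2), of w] C(1) vw(2) by (simp flip: w_def)
        moreover have "(\<Sum>c\<in>C. representation C (T c) c) = representation C (T w) w + representation C (T v) v"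
          by (subst (2) C2) (use vw(2) in simp)
        ultimately have "(\<Sum>c\<in>C. representation C (T c) c) = c" by simp
        then show False using basis[OF C(2,3)] less.prems(5) c(2) by simp
      qed
      then obtain x where x: "x \<in> C" "x \<noteq> v" "x \<noteq> w" using C(1) vw(2) by blast
      have "span {w, v} \<subseteq> span (C - {x})" by (rule span_mono) (use C(1) x in auto)
      then have "x \<notin> span {w, v}" using C(2) x(1) dependent_def by blast
      then have "x + v \<notin> span {w, v}"
        using span_diff[of "x + v" "{w, v}" v] span_base[of v "{w, v}"] by auto
      then have ind: "independent {x + v, w, v}" using vw(1) independent_insertI by blast
      have "x + v \<in> span B" using span_add[OF span_base[OF x(1)]] v(1) C(3) by simp
      then obtain E where E: "{x + v, w, v} \<subseteq> E" "independent E" "span E = span B"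
        using extend_to_basis[OF ind, of "span B"] v(1) w by auto
      obtain Q where Q: "endomorphism scale Q" "Q v = 0" "\<forall>d\<in>E - {v}. Q d = d"
        using compression[OF E(2)] E(1) by blast
      have xv: "x + v \<noteq> v" "x + v \<noteq> w"
        using \<open>x + v \<notin> span {w, v}\<close> span_base[of _ "{w, v}"] by auto
      \<comment> \<open>Modulo \<open>v\<close>, the new vector \<open>x + v\<close> is sent to \<open>c (x + v) + w\<close>.\<close>
      have "\<not> (\<forall>y\<in>span (E - {v}). Q (T y) = k *s y)" for k
      proof
        assume k: "\<forall>y\<in>span (E - {v}). Q (T y) = k *s y"
        have "endomorphism scale (\<lambda>y. y - P y)"
          using endo_minus[OF endo_ident P(1)] .
        moreover have "y - P y \<in> span {v}" if "y \<in> C" for y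
          using P(2,3) that by (cases "y = v") (auto simp: span_base span_zero)
        moreover have "T x \<in> span C" using span_base[OF x(1)] C(3) T(2) by blast
        ultimately have "T x - P (T x) \<in> span {v}" using endo_maps_span[of "\<lambda>y. y - P y" "span {v}" C "T x"] subspace_span by blast
        then obtain s where "T x - P (T x) = s *s v" by (auto simp: span_singleton)
        moreover have "P (T x) = c *s x" using c(1) x span_base[of x "C - {v}"] by simp
        ultimately have Tx: "T x = c *s x + s *s v" by (metis add.commute diff_add_cancel)
        have Qw: "Q w = w" and Qx: "Q (x + v) = x + v" using Q(3) E(1) vw(2) xv(1) by auto
        have "Q (T (x + v)) = c *s (x + v) + w"
          using Qx Q(2) by (simp add: endo_add[OF T(1)] endo_add[OF Q(1)] endo_scale[OF Q(1)] Tx Qw flip: w_def)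
        moreover have "Q (T (x + v)) = k *s (x + v)" using k E(1) xv(1) span_base[of "x + v" "E - {v}"] by simp
        ultimately have "w = (k - c) *s (x + v)" by (simp add: scale_left_diff_distrib algebra_simps)
        then have "w \<in> span {x + v}" by (auto simp: span_singleton)
        then have "w \<in> span ({x + v, w} - {w})" using xv by (simp add: insert_Diff_if)
        then have "dependent {x + v, w}" using dependent_def by blast
        then show False using independent_mono[OF ind, of "{x + v, w}"] by auto
      qed
      then show ?thesis using E(1) Q(3) by (intro reduce[OF E(2,3) _ _ Q(1,2)]) blast+
    qed
  qed
qed

section \<open>A section of a finite-rank map that avoids its range\<close>

text \<open>
  Start from any section \<open>s\<close> of \<open>u\<close> and correct it by vectors of the kernel: the
  set \<open>Z\<close> consists of kernel vectors independent of the range and of its image under \<open>s\<close>, one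
  for each basis vector of the range, and \<open>g\<close> adds to \<open>s\<close> the vector of \<open>Z\<close> assigned to the basis
  vector. A projection \<open>E\<close> onto the range can be prescribed freely on \<open>Z\<close>, hence made to kill the
  values of \<open>g\<close>.
\<close>

lemma generic_section:
  assumes u: "finite_rank_endomorphism scale u" and inf: "infinite_dimensional scale"
  shows "\<exists>g E. endomorphism scale g \<and> endomorphism scale E \<and> (\<forall>x\<in>range u. u (g x) = x)
    \<and> (\<forall>x. E x \<in> range u) \<and> (\<forall>x\<in>range u. E x = x) \<and> (\<forall>x\<in>range u. E (g x) = 0)"
proof -
  have eu: "endomorphism scale u" and fr: "finite_dim_subspace scale (range u)"
    using u unfolding finite_rank_endomorphism_def by auto
  have sr: "subspace (range u)" using fr unfolding finite_dim_subspace_def by blast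
  obtain A where A: "independent A" "span A = range u" using basis_of_subspace[OF sr] by blast
  have fA: "finite A" using finite_basis[OF fr A] .
  have Ar: "a \<in> range u" if "a \<in> A" for a using that A span_base by blast
  obtain s where s: "endomorphism scale s" "\<forall>a\<in>A. s a = (SOME y. u y = a)"
    using endo_extend[OF A(1), of "\<lambda>a. SOME y. u y = a"] by blast
  have us: "u (s a) = a" if "a \<in> A" for a
    using s(2) that someI_ex[of "\<lambda>y. u y = a"] Ar[OF that] by auto
  have usx: "u (s x) = x" if "x \<in> range u" for x
    using endo_eq_on_span[OF endo_comp[OF eu s(1)] endo_ident us] that A(2) by blast
  have "A \<subseteq> span (A \<union> s ` A)" using span_superset by blast
  then obtain S where S: "A \<subseteq> S" "independent S" "span S = span (A \<union> s ` A)"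
    using extend_to_basis[OF A(1) _ subspace_span] by meson
  have "finite_dim_subspace scale (span (A \<union> s ` A))"
    unfolding finite_dim_subspace_def using fA by (intro conjI exI[of _ "A \<union> s ` A"]) auto
  then have fS: "finite S" using finite_basis S(2,3) by blast
  have sS: "s a \<in> span S" if "a \<in> A" for a using that S(3) span_base[of "s a" "A \<union> s ` A"] by auto
  obtain D where D: "S \<subseteq> D" "D \<subseteq> S \<union> {x. u x = 0}" "independent D" "S \<union> {x. u x = 0} \<subseteq> span D"
    using maximal_independent_subset_extend[of S "S \<union> {x. u x = 0}"] S(2) by blast
  have spanD: "x \<in> span D" for x
  proof -
    have "u (x - s (u x)) = 0" by (simp add: endo_diff[OF eu] usx)
    then have "x - s (u x) \<in> span D" using D(4) by blast
    moreover have "s (u x) \<in> span S" using endo_maps_span[OF s(1) subspace_span sS, where x = "u x"] A(2) by blast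
    then have "s (u x) \<in> span D" using span_mono[OF D(1)] by blast
    ultimately show ?thesis using span_add by fastforce
  qed
  have "infinite D"
  proof
    assume "finite D"
    then have "finite_dim_subspace scale UNIV"
      unfolding finite_dim_subspace_def using spanD by (intro conjI exI[of _ D]) auto
    then show False using inf unfolding infinite_dimensional_def by blast
  qed
  then have "infinite (D - S)" using fS by simp
  then obtain Z where Z: "finite Z" "card Z = card A" "Z \<subseteq> D - S"
    using infinite_arbitrarily_large by metis
  then obtain h where h: "bij_betw h A Z" using finite_same_card_bij[OF fA Z(1)] by auto
  obtain E0 where E0: "endomorphism scale E0" "\<forall>x\<in>S. E0 x = (if x \<in> A then x else 0)"
    using endo_extend[OF S(2), of "\<lambda>x. if x \<in> A then x else 0"] by blast
  have E0r: "E0 x \<in> range u" if "x \<in> span S" for x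
    by (rule endo_maps_span[OF E0(1) sr _ that]) (use E0(2) Ar subspace_0[OF sr] in auto)
  obtain E where E: "endomorphism scale E" "\<forall>x\<in>D. E x =
      (if x \<in> S then E0 x else if x \<in> Z then - E0 (s (inv_into A h x)) else 0)"
    using endo_extend[OF D(3), of "\<lambda>x. if x \<in> S then E0 x else if x \<in> Z then - E0 (s (inv_into A h x)) else 0"]
    by blast
  have inv: "inv_into A h z \<in> A" if "z \<in> Z" for z
    using h that by (metis bij_betw_def inv_into_into)
  have ES: "E x = E0 x" if "x \<in> span S" for x
    by (rule endo_eq_on_span[OF E(1) E0(1) _ that]) (use E(2) D(1) in auto)
  have "E x \<in> range u" if "x \<in> D" for x
    using E(2) that E0r[OF span_base] E0r[OF sS[OF inv]] subspace_0[OF sr] subspace_neg[OF sr] by auto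
  then have Er: "E x \<in> range u" for x
    using endo_maps_span[OF E(1) sr _ spanD] by blast
  have "E x = x" if "x \<in> A" for x
    using that S(1) ES[OF span_base] E0(2) by auto
  then have EI: "E x = x" if "x \<in> range u" for x
    using endo_eq_on_span[OF E(1) endo_ident] that A(2) by blast
  obtain g where g: "endomorphism scale g" "\<forall>a\<in>A. g a = s a + h a"
    using endo_extend[OF A(1), of "\<lambda>a. s a + h a"] by blast
  have hZ: "h a \<in> Z" "inv_into A h (h a) = a" if "a \<in> A" for a
    using h that by (auto simp: bij_betw_def)
  have "u (h a) = 0" if "a \<in> A" for a using hZ(1)[OF that] Z(3) D(2) by auto
  then have ug: "u (g x) = x" if "x \<in> range u" for x
    using endo_eq_on_span[OF endo_comp[OF eu g(1)] endo_ident, of A x] g(2) us that A(2)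
    by (simp add: endo_add[OF eu])
  have "E (g a) = 0" if "a \<in> A" for a
  proof -
    have "E (h a) = - E0 (s a)" using E(2) hZ[OF that] Z(3) by auto
    then show ?thesis using g(2) that ES[OF sS[OF that]] by (simp add: endo_add[OF E(1)])
  qed
  then have "E (g x) = 0" if "x \<in> range u" for x
    using endo_eq_on_span[OF endo_comp[OF E(1) g(1)] endo_zero, of A x] that A(2) by simp
  then show ?thesis using g(1) E(1) ug Er EI by blast
qed

text \<open>
  Cut the basis into two halves of equal size: \<open>\<theta>\<close> maps the first half bijectively to the second
  one and kills the second, and \<open>\<rho>\<close> goes back.
\<close>

lemma even_dim_anticommuting_nilpotents:
  assumes A: "finite A" "independent A" "even (card A)"
  shows "\<exists>\<theta> \<rho>. endomorphism scale \<theta> \<and> endomorphism scale \<rho>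
    \<and> (\<forall>x\<in>span A. \<theta> x \<in> span A \<and> \<rho> x \<in> span A \<and> \<theta> (\<theta> x) = 0 \<and> \<rho> (\<rho> x) = 0 \<and> \<theta> (\<rho> x) + \<rho> (\<theta> x) = x)"
proof -
  obtain k where k: "card A = k + k" using A(3) by (metis evenE mult_2)
  obtain Y where Y: "Y \<subseteq> A" "card Y = k" using obtain_subset_with_card_n[of k A] k by auto
  have fY: "finite Y" using Y A(1) finite_subset by blast
  have "card (A - Y) = k" using k Y fY by (simp add: card_Diff_subset)
  then obtain f where f: "bij_betw f Y (A - Y)"
    using finite_same_card_bij[of Y "A - Y"] fY A(1) Y(2) by auto
  obtain \<theta> where t: "endomorphism scale \<theta>" "\<forall>x\<in>A. \<theta> x = (if x \<in> Y then f x else 0)"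
    using endo_extend[OF A(2), of "\<lambda>x. if x \<in> Y then f x else 0"] by blast
  obtain \<rho> where r: "endomorphism scale \<rho>" "\<forall>x\<in>A. \<rho> x = (if x \<in> Y then 0 else inv_into Y f x)"
    using endo_extend[OF A(2), of "\<lambda>x. if x \<in> Y then 0 else inv_into Y f x"] by blast
  have fx: "f x \<in> A" "f x \<notin> Y" "inv_into Y f (f x) = x" if "x \<in> Y" for x
    using f that by (auto simp: bij_betw_def)
  have ix: "inv_into Y f x \<in> Y" "f (inv_into Y f x) = x" if "x \<in> A" "x \<notin> Y" for x
    using f that by (auto simp: bij_betw_def f_inv_into_f inv_into_into)
  have b: "\<theta> x \<in> span A \<and> \<rho> x \<in> span A \<and> \<theta> (\<theta> x) = 0 \<and> \<rho> (\<rho> x) = 0 \<and> \<theta> (\<rho> x) + \<rho> (\<theta> x) = x"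
    if x: "x \<in> A" for x
  proof (cases "x \<in> Y")
    case True
    then show ?thesis
      using t(2) r(2) x fx[OF True] Y(1) endo_0[OF t(1)] endo_0[OF r(1)]
      by (auto simp: span_base span_zero)
  next
    case False
    then show ?thesis
      using t(2) r(2) x ix[OF x False] Y(1) endo_0[OF t(1)] endo_0[OF r(1)]
      by (auto simp: span_base span_zero subset_iff)
  qed
  have "\<theta> x \<in> span A \<and> \<rho> x \<in> span A \<and> \<theta> (\<theta> x) = 0 \<and> \<rho> (\<rho> x) = 0 \<and> \<theta> (\<rho> x) + \<rho> (\<theta> x) = x"
    if x: "x \<in> span A" for x
    using b endo_maps_span[OF t(1) subspace_span _ x] endo_maps_span[OF r(1) subspace_span _ x]
      endo_eq_on_span[OF endo_comp[OF t(1) t(1)] endo_zero _ x]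
      endo_eq_on_span[OF endo_comp[OF r(1) r(1)] endo_zero _ x]
      endo_eq_on_span[OF endo_plus[OF endo_comp[OF t(1) r(1)] endo_comp[OF r(1) t(1)]] endo_ident _ x]
    by blast
  then show ?thesis using t(1) r(1) by blast
qed

end

section \<open>Sums of two idempotents in characteristic 2\<close>

locale char2_vector_space = vector_space scale
  for scale :: "'f::field \<Rightarrow> 'v::ab_group_add \<Rightarrow> 'v" (infixr "*s" 75) +
  assumes char2: "CHAR('f) = 2"
begin

interpretation self: vector_space_pair scale scale
  by unfold_locales

lemma one_plus_one: "(1::'f) + 1 = 0"
  using of_nat_CHAR[where 'a = 'f] char2 by simp

lemma add_self [simp]: "x + x = (0::'v)"
  using scale_left_distrib[of 1 1 x] one_plus_one by simp

lemma add_self_left [simp]: "x + (x + y) = (y::'v)"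
  using add.assoc[of x x y] by simp

text \<open>
  The grading given by \<open>P\<close> makes \<open>N\<close> off-diagonal, \<open>N = [[0, Y], [X, 0]]\<close> in block form, and then
  \<open>P + N P = [[1, 0], [X, 0]]\<close> and \<open>P + P N = [[1, Y], [0, 0]]\<close> are idempotents with sum \<open>N\<close>. The
  idempotent \<open>e\<close> lives on a complementary summand, where it can be added to either of the two.
\<close>

lemma sum_of_two_idempotents:
  assumes "endomorphism scale P" "endomorphism scale N" "endomorphism scale e"
    and PP: "\<And>x. P (P x) = P x" and PN: "\<And>x. P (N x) + N (P x) = N x"
    and ee: "\<And>x. e (e x) = e x" and eP: "\<And>x. e (P x) = 0" and Pe: "\<And>x. P (e x) = 0"
    and eN: "\<And>x. e (N x) = 0" and Ne: "\<And>x. N (e x) = 0"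
  shows "\<exists>p q. idempotent_endomorphism scale p \<and> idempotent_endomorphism scale q
    \<and> (\<forall>x. N x + e x = p x + q x)"
proof -
  note lin = endo_add[OF assms(1)] endo_add[OF assms(2)] endo_add[OF assms(3)]
  have PNP: "P (N (P x)) = 0" for x
    using PN[of "P x"] PP by (metis add_self add_self_left add.commute)
  have "idempotent_endomorphism scale (\<lambda>x. P x + N (P x))"
    unfolding idempotent_endomorphism_def
    using endo_plus[OF assms(1) endo_comp[OF assms(2,1)]] endo_0[OF assms(2)]
    by (auto simp: fun_eq_iff lin PP PNP)
  moreover have "idempotent_endomorphism scale (\<lambda>x. P x + P (N x) + e x)"
    unfolding idempotent_endomorphism_def
    using endo_plus[OF endo_plus[OF assms(1) endo_comp[OF assms(1,2)]] assms(3)] endo_0[OF assms(1)]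
    by (auto simp: fun_eq_iff lin PP PNP ee eP Pe Ne)
  moreover have "N x + e x = (P x + N (P x)) + (P x + P (N x) + e x)" for x
    using PN[of x] by (simp add: add_ac)
  ultimately show ?thesis by blast
qed

text \<open>
  Without a Jordan basis: a grading \<open>P'\<close> of \<open>N W\<close> is extended to \<open>W\<close>. On a basis vector \<open>d\<close> outside
  \<open>N W\<close> and the kernel of \<open>N\<close>, the relation demands that \<open>N\<close> sends \<open>P d\<close> to \<open>N d + P' (N d)\<close>, and
  any preimage serves; on kernel vectors outside \<open>N W\<close> the value 0 serves. The resulting \<open>P\<close> satisfies
  \<open>P N + N P = N\<close> but need not be idempotent. Its defect \<open>P\<^sup>2 + P\<close> vanishes on \<open>N W\<close> and on the
  kernel of \<open>N\<close> and takes its values in that kernel, so its square \<open>P\<^sup>4 + P\<^sup>2\<close> vanishes: in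
  characteristic 2 this says that \<open>P\<^sup>2\<close> is idempotent, and \<open>P\<^sup>2\<close> satisfies the same relation with \<open>N\<close>.
\<close>

lemma nilpotent_grading:
  assumes N: "endomorphism scale N"
  shows "\<lbrakk>subspace W; N ` W \<subseteq> W; \<forall>x\<in>W. (N ^^ m) x = 0\<rbrakk> \<Longrightarrow>
    \<exists>P. endomorphism scale P \<and> (\<forall>x\<in>W. P x \<in> W \<and> P (P x) = P x \<and> P (N x) + N (P x) = N x)"
proof (induction m arbitrary: W)
  case 0
  then have "\<forall>x\<in>W. 0 \<in> W \<and> 0 + N 0 = N x" using endo_0[OF N] by auto
  then show ?case using endo_zero by (intro exI[of _ "\<lambda>x. 0"]) auto
next
  case (Suc m)
  note W = Suc.prems(1,2)
  define W' where "W' = N ` W"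
  have sW': "subspace W'"
    unfolding W'_def using self.linear_subspace_image[OF N[unfolded endomorphism_def] W(1)] .
  have W'W: "W' \<subseteq> W" using W(2) W'_def by simp
  have NW: "N x \<in> W'" if "x \<in> W" for x using that W'_def by simp
  have "\<exists>P. endomorphism scale P \<and> (\<forall>x\<in>W'. P x \<in> W' \<and> P (P x) = P x \<and> P (N x) + N (P x) = N x)"
  proof (rule Suc.IH[OF sW'])
    show "N ` W' \<subseteq> W'" using NW W'W by blast
    show "\<forall>x\<in>W'. (N ^^ m) x = 0" using Suc.prems(3) unfolding W'_def by (simp add: funpow_swap1)
  qed
  then obtain P' where P': "endomorphism scale P'"
    and P'W: "\<And>x. x \<in> W' \<Longrightarrow> P' x \<in> W'" and P'P: "\<And>x. x \<in> W' \<Longrightarrow> P' (P' x) = P' x"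
    and P'N: "\<And>x. x \<in> W' \<Longrightarrow> P' (N x) + N (P' x) = N x" by blast
  define K where "K = {x \<in> W. N x = 0}"
  obtain D1 where D1: "independent D1" "span D1 = W'" using basis_of_subspace[OF sW'] by blast
  have D1W: "D1 \<subseteq> W'" using D1 span_superset by blast
  obtain D2 where D2: "D1 \<subseteq> D2" "D2 \<subseteq> D1 \<union> K" "independent D2" "D1 \<union> K \<subseteq> span D2"
    using maximal_independent_subset_extend[of D1 "D1 \<union> K"] D1(1) by blast
  have D2W: "D2 \<subseteq> W" using D2(2) D1W W'W unfolding K_def by blast
  obtain D where D: "D2 \<subseteq> D" "independent D" "span D = W"
    using extend_to_basis[OF D2(3) D2W W(1)] by blast
  have DW: "D \<subseteq> W" using D span_superset by blast
  have "\<exists>y\<in>W. N y = N d + P' (N d)" if "d \<in> W" for d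
    using subspace_add[OF sW' NW[OF that] P'W[OF NW[OF that]]] unfolding W'_def by auto
  then obtain Y where Y: "\<And>d. d \<in> W \<Longrightarrow> Y d \<in> W \<and> N (Y d) = N d + P' (N d)" by metis
  obtain P where P: "endomorphism scale P"
    and PD: "\<forall>d\<in>D. P d = (if d \<in> D1 then P' d else if d \<in> D2 then 0 else Y d)"
    using endo_extend[OF D(2), of "\<lambda>d. if d \<in> D1 then P' d else if d \<in> D2 then 0 else Y d"] by blast
  have PP': "P x = P' x" if "x \<in> W'" for x
    by (rule endo_eq_on_span[OF P P', of D1]) (use PD D D2 D1 that in auto)
  have PW: "P x \<in> W" if "x \<in> W" for x
  proof (rule endo_maps_span[OF P W(1), of D])
    show "P d \<in> W" if "d \<in> D" for d
      using PD that Y[of d] DW D1W P'W[of d] W'W subspace_0[OF W(1)] by auto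
  qed (use D(3) that in simp)
  have rel: "P (N x) + N (P x) = N x" if "x \<in> W" for x
  proof (rule endo_eq_on_span[OF endo_plus[OF endo_comp[OF P N] endo_comp[OF N P]] N, of D])
    show "P (N d) + N (P d) = N d" if d: "d \<in> D" for d
    proof -
      have "P (N d) = P' (N d)" using PP' NW DW d by blast
      moreover have "N d = 0" if "d \<in> D2" "d \<notin> D1" using that D2(2) unfolding K_def by blast
      moreover have "N (Y d) = N d + P' (N d)" using Y d DW by blast
      ultimately show ?thesis
        using PD d P'N[of d] D1W endo_0[OF N] endo_0[OF P']
        by (cases "d \<in> D1"; cases "d \<in> D2") (auto simp: add_ac)
    qed
  qed (use D(3) that in simp)
  have PPW': "P (P x) = P x" if "x \<in> W'" for x using PP' P'P P'W that by simp
  have PPD2: "P (P x) = P x" if "x \<in> span D2" for x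
  proof (rule endo_eq_on_span[OF endo_comp[OF P P] P _ that])
    show "P (P d) = P d" if "d \<in> D2" for d
      using that PD D(1) PPW' D1W endo_0[OF P] by (cases "d \<in> D1") auto
  qed
  have NP: "N (P (P x)) = N (P x)" if "x \<in> W" for x
  proof -
    have "N (P x) = N x + P (N x)" using rel[OF that] by (metis add_self_left add.commute)
    then have "P (N (P x)) = 0" using PPW'[OF NW[OF that]] by (simp add: endo_add[OF P])
    then show ?thesis using rel[OF PW[OF that]] by simp
  qed
  have QQ: "P (P (P (P x))) = P (P x)" if "x \<in> W" for x
  proof -
    have "P (P x) + P x \<in> K"
      unfolding K_def using NP[OF that] PW that subspace_add[OF W(1)] by (simp add: endo_add[OF N])
    then have "P (P (P (P x) + P x)) = P (P (P x) + P x)" using PPD2 D2(4) by blast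
    then have "P (P (P (P x))) + P (P (P x)) = P (P (P x)) + P (P x)" by (simp add: endo_add[OF P])
    then show ?thesis by (simp add: add.commute)
  qed
  have "P (P (N x)) + N (P (P x)) = N x" if "x \<in> W" for x
    using PPW'[OF NW[OF that]] NP[OF that] rel[OF that] by simp
  then show ?case
    using endo_comp[OF P P] PW QQ by (intro exI[of _ "\<lambda>x. P (P x)"]) simp
qed

text \<open>
  The Fitting decomposition: \<open>e = B\<^sup>m\<close> is idempotent, \<open>B\<close> is nilpotent on the kernel of \<open>e\<close>
  and the identity on its image. The grading of the kernel, extended by 0, makes \<open>B + e\<close> odd.
\<close>

lemma stable_powers_sum_of_two_idempotents:
  assumes B: "endomorphism scale B" and M: "\<And>x. (B ^^ Suc m) x = (B ^^ m) x"
  shows "\<exists>p q. idempotent_endomorphism scale p \<and> idempotent_endomorphism scale q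
    \<and> (\<forall>x. B x = p x + q x)"
proof -
  define e where "e = B ^^ m"
  have e: "endomorphism scale e" unfolding e_def using endo_funpow[OF B] .
  have Be: "B (e x) = e x" for x using M by (simp add: e_def)
  have eB: "e (B x) = e x" for x using M[of x] by (simp add: e_def funpow_swap1)
  have "e ((B ^^ i) x) = e x" for i x by (induction i) (simp_all add: eB)
  then have ee: "e (e x) = e x" for x by (simp add: e_def)
  note lin = endo_add[OF B] endo_add[OF e] endo_0[OF B] endo_0[OF e]
  define W where "W = {x. e x = 0}"
  have W1: "subspace W"
    unfolding W_def using self.linear_subspace_kernel[OF e[unfolded endomorphism_def]] .
  have W2: "B ` W \<subseteq> W" unfolding W_def by (auto simp: eB)
  have W3: "\<forall>x\<in>W. (B ^^ m) x = 0" unfolding W_def e_def by simp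
  obtain P where P: "endomorphism scale P"
    and PW: "\<And>x. x \<in> W \<Longrightarrow> P x \<in> W" and PP: "\<And>x. x \<in> W \<Longrightarrow> P (P x) = P x"
    and PB: "\<And>x. x \<in> W \<Longrightarrow> P (B x) + B (P x) = B x"
    using nilpotent_grading[OF B W1 W2 W3] by blast
  have z: "x + e x \<in> W" for x unfolding W_def by (simp add: lin ee)
  have eP: "e (P (x + e x)) = 0" for x using PW[OF z] unfolding W_def by blast
  have c1: "P (B x + e x + e (B x + e x)) + (B (P (x + e x)) + e (P (x + e x))) = B x + e x" for x
    using PB[OF z[of x]] eP[of x] by (simp add: lin Be eB ee)
  have c2: "P (P (x + e x) + e (P (x + e x))) = P (x + e x)" for x
    using PP[OF z] eP by simp
  have c3: "P (e x + e (e x)) = 0" for x using endo_0[OF P] by (simp add: ee)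
  have c4: "e (B x + e x) = 0" "B (e x) + e (e x) = 0" for x by (simp_all add: lin Be eB ee)
  have "\<exists>p q. idempotent_endomorphism scale p \<and> idempotent_endomorphism scale q
    \<and> (\<forall>x. (B x + e x) + e x = p x + q x)"
    by (rule sum_of_two_idempotents[OF endo_comp[OF P endo_plus[OF endo_ident e]] endo_plus[OF B e] e
          c2 c1 ee eP c3 c4])
  moreover have "B x + e x + e x = B x" for x by (simp add: add.assoc)
  ultimately show ?thesis by simp
qed

end

section \<open>Correcting a finite-rank map by an idempotent\<close>

text \<open>
  The situation that \<open>generic_section\<close> provides: \<open>g\<close> is a section of \<open>u\<close> over its range, and \<open>E\<close> is a
  projection onto the range that kills the image of the section.
\<close>

locale range_section = char2_vector_space scale
  for scale :: "'f::field \<Rightarrow> 'v::ab_group_add \<Rightarrow> 'v" (infixr "*s" 75) +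
  fixes u g E :: "'v \<Rightarrow> 'v"
  assumes endo_u: "endomorphism scale u" and endo_g: "endomorphism scale g" and endo_E: "endomorphism scale E"
    and u_g: "x \<in> range u \<Longrightarrow> u (g x) = x"
    and E_range: "E x \<in> range u"
    and E_id: "x \<in> range u \<Longrightarrow> E x = x"
    and E_g: "x \<in> range u \<Longrightarrow> E (g x) = 0"
begin

lemma u_0: "u 0 = 0" and g_0: "g 0 = 0" and E_0: "E 0 = 0"
  using endo_0 endo_u endo_g endo_E by auto

lemma range_0: "0 \<in> range u"
  using u_0 by (metis rangeI)

lemma range_add: "x \<in> range u \<Longrightarrow> y \<in> range u \<Longrightarrow> x + y \<in> range u"
  using endo_add[OF endo_u] by (auto simp flip: endo_add[OF endo_u])

lemma range_scale: "x \<in> range u \<Longrightarrow> c *s x \<in> range u"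
  by (auto simp flip: endo_scale[OF endo_u])

text \<open>
  The space is the direct sum of the range of \<open>u\<close>, the image of the section, and the common
  kernel of \<open>u\<close> and \<open>E\<close>; the coordinates of \<open>x\<close> in the first two are \<open>E x\<close> and \<open>u (x + E x)\<close>.
\<close>

lemma decomposition:
  obtains k where "x = E x + g (u (x + E x)) + k" "u k = 0" "E k = 0"
proof -
  define k where "k = x + E x + g (u (x + E x))"
  have "u k = u (x + E x) + u (g (u (x + E x)))" unfolding k_def by (rule endo_add[OF endo_u])
  then have "u k = 0" using u_g[OF rangeI, of "x + E x"] by simp
  moreover have "E k = 0" unfolding k_def by (simp add: endo_add[OF endo_E] E_g E_id E_range)
  moreover have "x = E x + g (u (x + E x)) + k" unfolding k_def by (simp add: add_ac)
  ultimately show ?thesis using that by blast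
qed

text \<open>
  The projection onto the graph \<open>{c + g (n c)}\<close> of \<open>g \<circ> n\<close> over the range of \<open>u\<close>, along the kernel
  of \<open>E\<close>.
\<close>

definition correction :: "('v \<Rightarrow> 'v) \<Rightarrow> 'v \<Rightarrow> 'v" where
  "correction n x = E x + g (n (E x))"

context
  fixes n :: "'v \<Rightarrow> 'v"
  assumes n: "endomorphism scale n" and n_img: "n ` range u \<subseteq> range u"
begin

lemma n_range: "x \<in> range u \<Longrightarrow> n x \<in> range u"
  using n_img by blast

lemma endo_correction: "endomorphism scale (correction n)"
  unfolding correction_def[abs_def] using endo_plus[OF endo_E endo_comp[OF endo_g endo_comp[OF n endo_E]]] .

lemma idempotent_correction: "idempotent_endomorphism scale (correction n)"
  unfolding idempotent_endomorphism_def using endo_correction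
  by (auto simp: fun_eq_iff correction_def endo_add[OF endo_E] E_g E_id E_range n_range)

lemma endo_u_correction: "endomorphism scale (\<lambda>x. u x + correction n x)"
  using endo_plus[OF endo_u endo_correction] .

lemma u_correction_range: "c \<in> range u \<Longrightarrow> u c + correction n c = (u c + c) + g (n c)"
  by (simp add: correction_def E_id add.assoc)

lemma u_correction_section: "d \<in> range u \<Longrightarrow> u (g d) + correction n (g d) = d"
  by (simp add: correction_def E_g u_g endo_0[OF n] g_0)

lemma u_correction_ker: "u k = 0 \<Longrightarrow> E k = 0 \<Longrightarrow> u k + correction n k = 0"
  by (simp add: correction_def endo_0[OF n] g_0)

lemma sum_of_three_idempotents_if_corrected:
  assumes "\<exists>p q. idempotent_endomorphism scale p \<and> idempotent_endomorphism scale q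
    \<and> (\<forall>x. u x + correction n x = p x + q x)"
  shows "\<exists>p q r. idempotent_endomorphism scale p \<and> idempotent_endomorphism scale q
    \<and> idempotent_endomorphism scale r \<and> (\<forall>x. u x = p x + q x + r x)"
proof -
  obtain p q where pq: "idempotent_endomorphism scale p" "idempotent_endomorphism scale q"
    and sum: "\<And>x. u x + correction n x = p x + q x" using assms by blast
  have "u x = p x + q x + correction n x" for x
    by (simp add: add.assoc flip: sum)
  then show ?thesis using pq idempotent_correction by blast
qed

end

text \<open>
  With \<open>n = U L\<close>, the vectors \<open>X c = c + g (U c)\<close> form a \<open>B\<close>-invariant subspace on which \<open>B\<close> acts
  as \<open>L\<close>; modulo this subspace \<open>B\<close> acts on the vectors \<open>g d\<close> as the nilpotent map \<open>U\<close>, and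
  it kills the rest. Hence the powers of \<open>B\<close> stabilise.
\<close>

lemma sum_of_three_idempotents_if_splits:
  assumes "splits_on scale (range u) (\<lambda>x. u x + x)"
  shows "\<exists>p q r. idempotent_endomorphism scale p \<and> idempotent_endomorphism scale q
    \<and> idempotent_endomorphism scale r \<and> (\<forall>x. u x = p x + q x + r x)"
proof -
  obtain U L m where U: "endomorphism scale U" and L: "endomorphism scale L"
    and "U ` range u \<subseteq> range u" "L ` range u \<subseteq> range u"
    and UL: "\<forall>x\<in>range u. u x + x = U x + L x \<and> (U ^^ m) x = 0 \<and> (L ^^ Suc m) x = (L ^^ m) x"
    using assms unfolding splits_on_def by blast
  then have Ur: "U x \<in> range u" and Lr: "L x \<in> range u" if "x \<in> range u" for x
    using that by blast+
  define n where "n x = U (L x)" for x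
  have n: "endomorphism scale n" unfolding n_def[abs_def] using endo_comp[OF U L] .
  have nr: "n ` range u \<subseteq> range u" using Ur Lr unfolding n_def by blast
  note u_corr = u_correction_range[OF n nr] u_correction_section[OF n nr] u_correction_ker[OF n nr]
  define B where "B x = u x + correction n x" for x
  have B: "endomorphism scale B" unfolding B_def[abs_def] using endo_u_correction[OF n nr] .
  define X where "X c = c + g (U c)" for c
  have Xadd: "X c + X d = X (c + d)" for c d
    by (simp add: X_def endo_add[OF U] endo_add[OF endo_g] add_ac)
  have Bg: "B (g d) = d" if "d \<in> range u" for d using u_corr(2)[OF that] by (simp add: B_def)
  have BX: "B (X c) = X (L c)" if c: "c \<in> range u" for c
  proof -
    have "B c = (U c + L c) + g (U (L c))"
      using u_corr(1)[OF c] UL c by (simp add: B_def n_def)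
    then show ?thesis
      using Bg[OF Ur[OF c]] by (simp add: X_def endo_add[OF B] add_ac)
  qed
  have powX: "(B ^^ i) (X c) = X ((L ^^ i) c) \<and> (L ^^ i) c \<in> range u" if "c \<in> range u" for c i
    by (induction i) (simp_all add: that BX Lr)
  have stableX: "(B ^^ Suc m) (X c) = (B ^^ m) (X c)" if "c \<in> range u" for c
  proof -
    have "(L ^^ Suc m) c = (L ^^ m) c" using UL that by blast
    then show ?thesis using powX[OF that, of m] powX[OF that, of "Suc m"] by simp
  qed
  have powg: "\<exists>c\<in>range u. (B ^^ i) (g d) = X c + g ((U ^^ i) d) \<and> (U ^^ i) d \<in> range u"
    if d: "d \<in> range u" for d i
  proof (induction i)
    case 0
    show ?case using d range_0 by (intro bexI[of _ 0]) (simp_all add: X_def endo_0[OF U] g_0)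
  next
    case (Suc i)
    then obtain c where c: "c \<in> range u" "(B ^^ i) (g d) = X c + g ((U ^^ i) d)" "(U ^^ i) d \<in> range u"
      by blast
    have "(B ^^ Suc i) (g d) = X (L c) + (U ^^ i) d"
      by (simp add: c(2) endo_add[OF B] BX[OF c(1)] Bg[OF c(3)])
    also have "(U ^^ i) d = X ((U ^^ i) d) + g ((U ^^ Suc i) d)"
      by (simp add: X_def add.assoc)
    finally have "(B ^^ Suc i) (g d) = X (L c + (U ^^ i) d) + g ((U ^^ Suc i) d)"
      by (simp add: add.assoc flip: Xadd)
    then show ?case
      using range_add[OF Lr[OF c(1)] c(3)] Ur[OF c(3)] by (intro bexI[of _ "L c + (U ^^ i) d"]) simp_all
  qed
  have later: "(B ^^ Suc (i + j)) y = (B ^^ (i + j)) y" if "(B ^^ Suc i) y = (B ^^ i) y" for i j y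
    using that by (induction j) simp_all
  define M where "M = Suc (m + m)"
  note linM = endo_add[OF endo_funpow[OF B, of M]] endo_add[OF endo_funpow[OF B, of "Suc M"]]
  have gM: "(B ^^ Suc M) (g d) = (B ^^ M) (g d)" if d: "d \<in> range u" for d
  proof -
    obtain c where c: "c \<in> range u" "(B ^^ m) (g d) = X c"
      using powg[OF d, of m] UL d g_0 by auto
    have "(B ^^ Suc (m + m)) (g d) = (B ^^ Suc m) ((B ^^ m) (g d))"
      by (simp add: funpow_add)
    also have "\<dots> = (B ^^ (m + m)) (g d)"
      by (simp only: c(2) stableX[OF c(1)]) (simp add: funpow_add c(2))
    finally show ?thesis using later[of "m + m" "g d" 1] by (simp add: M_def)
  qed
  have XM: "(B ^^ Suc M) (X c) = (B ^^ M) (X c)" if "c \<in> range u" for c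
    using later[OF stableX[OF that], of "Suc m"] by (simp add: M_def)
  have kM: "(B ^^ Suc M) k = (B ^^ M) k" if k: "u k = 0" "E k = 0" for k
  proof -
    have "B k = 0" using u_corr(3)[OF k] by (simp add: B_def)
    then show ?thesis using later[of 1 k "m + m"] endo_0[OF B] by (simp add: M_def)
  qed
  have "(B ^^ Suc M) x = (B ^^ M) x" for x
  proof -
    obtain k where x: "x = E x + g (u (x + E x)) + k" and k: "u k = 0" "E k = 0"
      by (rule decomposition)
    have "E x = X (E x) + g (U (E x))" by (simp add: X_def add.assoc)
    then have x': "x = X (E x) + g (U (E x)) + g (u (x + E x)) + k" using x by simp
    have "(B ^^ Suc M) (X c + g d + g d' + k) = (B ^^ M) (X c + g d + g d' + k)"
      if "c \<in> range u" "d \<in> range u" "d' \<in> range u" for c d d'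
      unfolding linM using XM gM kM[OF k] that by simp
    from this[OF E_range Ur[OF E_range] rangeI] show ?thesis by (subst (1 2) x')
  qed
  from stable_powers_sum_of_two_idempotents[OF B this]
  show ?thesis unfolding B_def by (rule sum_of_three_idempotents_if_corrected[OF n nr])
qed

text \<open>
  With \<open>n = \<theta>\<close> the grading is found in rank 2, where the range has a basis \<open>y\<^sub>1\<close>, \<open>y\<^sub>2\<close> with
  \<open>\<theta> y\<^sub>1 = y\<^sub>2\<close>; put \<open>x\<^sub>i = g y\<^sub>i\<close>. Then \<open>B\<close> maps \<open>x\<^sub>1\<close> to \<open>y\<^sub>1\<close>, \<open>y\<^sub>1\<close> to \<open>x\<^sub>2 + c y\<^sub>1\<close>,
  \<open>x\<^sub>2 + c y\<^sub>1\<close> to \<open>(y\<^sub>2 + c x\<^sub>2) + c\<^sup>2 y\<^sub>1\<close>, and \<open>y\<^sub>2 + c x\<^sub>2\<close> to 0. So \<open>B\<close> maps each of the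
  spans of \<open>x\<^sub>1\<close>, \<open>x\<^sub>2 + c y\<^sub>1\<close> and of \<open>y\<^sub>1\<close>, \<open>y\<^sub>2 + c x\<^sub>2\<close> into the other. The map \<open>P\<close> of the proof is the
  projection onto the former along the latter, written with \<open>\<theta>\<close> and \<open>\<rho>\<close> instead of a basis.
\<close>

lemma sum_of_three_idempotents_if_scalar:
  assumes c: "\<And>x. x \<in> range u \<Longrightarrow> u x + x = c *s x"
    and t: "endomorphism scale \<theta>" and r: "endomorphism scale \<rho>"
    and tr: "\<And>x. x \<in> range u \<Longrightarrow> \<theta> x \<in> range u" "\<And>x. x \<in> range u \<Longrightarrow> \<rho> x \<in> range u"
    and tt: "\<And>x. x \<in> range u \<Longrightarrow> \<theta> (\<theta> x) = 0" and rr: "\<And>x. x \<in> range u \<Longrightarrow> \<rho> (\<rho> x) = 0"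
    and anti: "\<And>x. x \<in> range u \<Longrightarrow> \<theta> (\<rho> x) + \<rho> (\<theta> x) = x"
  shows "\<exists>p q r. idempotent_endomorphism scale p \<and> idempotent_endomorphism scale q
    \<and> idempotent_endomorphism scale r \<and> (\<forall>x. u x = p x + q x + r x)"
proof -
  have t_img: "\<theta> ` range u \<subseteq> range u" using tr(1) by blast
  note u_corr = u_correction_range[OF t t_img] u_correction_section[OF t t_img] u_correction_ker[OF t t_img]
  define B where "B x = u x + correction \<theta> x" for x
  have B: "endomorphism scale B" unfolding B_def[abs_def] using endo_u_correction[OF t t_img] .
  define d where "d x = u (x + E x)" for x
  have dr: "d x \<in> range u" for x by (simp add: d_def)
  have de: "endomorphism scale d"
    unfolding d_def[abs_def] using endo_comp[OF endo_u endo_plus[OF endo_ident endo_E]] .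
  have coords: "E (a + g b) = a" "d (a + g b) = b" if "a \<in> range u" "b \<in> range u" for a b
    using that by (simp_all add: d_def endo_add[OF endo_E] endo_add[OF endo_u] E_id E_g u_g)
  have Bx: "B x = (c *s E x + d x) + g (\<theta> (E x))" for x
  proof -
    obtain k where x: "x = E x + g (d x) + k" and k: "u k = 0" "E k = 0"
      unfolding d_def by (rule decomposition)
    have "B x = B (E x) + B (g (d x)) + B k" by (subst x) (simp add: endo_add[OF B])
    moreover have "B (E x) = c *s E x + g (\<theta> (E x))"
      using u_corr(1)[OF E_range] c[OF E_range] by (simp add: B_def)
    moreover have "B (g (d x)) = d x" using u_corr(2)[OF dr] by (simp add: B_def)
    moreover have "B k = 0" using u_corr(3)[OF k] by (simp add: B_def)
    ultimately show ?thesis by (simp add: add_ac)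
  qed
  define P where "P x = (c *s \<rho> (d x) + (c * c) *s \<rho> (E x)) + g (d x + c *s \<theta> (\<rho> (E x)))" for x
  have P: "endomorphism scale P"
    unfolding P_def[abs_def]
    by (rule endo_plus endo_comp[OF endo_mult] endo_comp[OF endo_g] endo_comp[OF r] endo_comp[OF t] de endo_E)+
  have anti': "\<rho> (\<theta> x) = x + \<theta> (\<rho> x)" if "x \<in> range u" for x
    using anti[OF that] by (metis add_self_left add.commute)
  note lin = endo_add[OF t] endo_add[OF r] endo_add[OF endo_g] endo_add[OF de] endo_add[OF endo_E]
    endo_scale[OF t] endo_scale[OF r] endo_scale[OF endo_g] endo_scale[OF de] endo_scale[OF endo_E]
    endo_0[OF t] endo_0[OF r] g_0
  note ranges = range_add range_scale tr E_range dr
  have EP: "E (P x) = c *s \<rho> (d x) + (c * c) *s \<rho> (E x)"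
    and dP: "d (P x) = d x + c *s \<theta> (\<rho> (E x))" for x
    unfolding P_def by (simp_all add: coords ranges)
  have EB: "E (B x) = c *s E x + d x" and dB: "d (B x) = \<theta> (E x)" for x
    unfolding Bx by (simp_all add: coords ranges)
  have PP: "P (P x) = P x" for x
    unfolding P_def[of "P x"] EP dP unfolding P_def
    by (simp add: lin ranges tt rr anti' scale_right_distrib)
  have PB: "P (B x) + B (P x) = B x" for x
    unfolding P_def[of "B x"]
    unfolding Bx[of "P x"] EP dP EB dB
    unfolding Bx[of x]
    by (simp add: lin ranges tt rr anti' scale_right_distrib mult.assoc add_ac)
  have "\<exists>p q. idempotent_endomorphism scale p \<and> idempotent_endomorphism scale q
      \<and> (\<forall>x. B x + 0 = p x + q x)"
    by (rule sum_of_two_idempotents[OF P B endo_zero PP PB]) (simp_all add: endo_0[OF B] endo_0[OF P])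
  then have "\<exists>p q. idempotent_endomorphism scale p \<and> idempotent_endomorphism scale q
      \<and> (\<forall>x. u x + correction \<theta> x = p x + q x)"
    unfolding B_def by simp
  then show ?thesis by (rule sum_of_three_idempotents_if_corrected[OF t t_img])
qed

end

context char2_vector_space
begin

section \<open>Finite-rank endomorphisms\<close>

lemma of_nat_char2: "(of_nat k :: 'f) = (if even k then 0 else 1)"
proof (induction k)
  case (Suc k)
  then show ?case using one_plus_one by auto
qed simp

text \<open>
  The scalar case that does not split forces even rank: in odd rank the trace of the scalar
  map is its factor, which would then be 0 or 1.
\<close>

theorem finite_rank_sum_of_three_idempotents:
  assumes inf: "infinite_dimensional scale" and u: "finite_rank_endomorphism scale u"
    and tr: "finite_rank_trace scale u \<in> {0, 1}"
  shows "\<exists>p q r. idempotent_endomorphism scale p \<and> idempotent_endomorphism scale q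
    \<and> idempotent_endomorphism scale r \<and> (\<forall>x. u x = p x + q x + r x)"
proof -
  have eu: "endomorphism scale u" and fr: "finite_dim_subspace scale (range u)"
    using u unfolding finite_rank_endomorphism_def by auto
  obtain g E where "endomorphism scale g" "endomorphism scale E" "\<forall>x\<in>range u. u (g x) = x"
    "\<forall>x. E x \<in> range u" "\<forall>x\<in>range u. E x = x" "\<forall>x\<in>range u. E (g x) = 0"
    using generic_section[OF u inf] by blast
  then interpret range_section scale u g E
    using eu by unfold_locales blast+
  obtain A where A: "independent A" "span A = range u"
    using basis_of_subspace fr unfolding finite_dim_subspace_def by blast
  have fA: "finite A" using finite_basis[OF fr A] .
  define T where "T x = u x + x" for x
  have T: "endomorphism scale T" unfolding T_def[abs_def] using endo_plus[OF eu endo_ident] .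
  have Tr: "T ` span A \<subseteq> span A" unfolding A(2) T_def using range_add by blast
  have "representation A (T a) a = representation A (u a) a + 1" if "a \<in> A" for a
    using that A unfolding T_def
    by (subst representation_add) (auto simp: representation_basis span_base)
  then have "(\<Sum>a\<in>A. representation A (T a) a) = (\<Sum>a\<in>A. representation A (u a) a) + of_nat (card A)"
    by (simp add: sum.distrib)
  also have "(\<Sum>a\<in>A. representation A (u a) a) = finite_rank_trace scale u"
    using finite_rank_trace_eq[OF u fr order_refl] trace_on_eq_basis[OF eu fr _ A] by (simp add: image_subset_iff)
  finally have trT: "(\<Sum>a\<in>A. representation A (T a) a) \<in> {0, 1}"
    using tr one_plus_one by (auto simp: of_nat_char2)
  show ?thesis
  proof (cases "\<exists>c. (\<forall>x\<in>span A. T x = c *s x) \<and> c \<notin> {0, 1}")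
    case False
    then have "splits_on scale (span A) T"
      using splits_on_of_trace[OF fA A(1) T Tr trT] by blast
    then show ?thesis
      using sum_of_three_idempotents_if_splits unfolding T_def A(2) by blast
  next
    case True
    then obtain c where c: "\<forall>x\<in>span A. T x = c *s x" "c \<notin> {0, 1}" by blast
    then have "(\<Sum>a\<in>A. representation A (T a) a) = of_nat (card A) * c"
      using trace_scalar[OF A(1), of T c] span_base by blast
    then have "even (card A)" using trT c(2) by (auto simp: of_nat_char2 split: if_splits)
    then obtain \<theta> \<rho> where t: "endomorphism scale \<theta>" "endomorphism scale \<rho>"
      and "\<forall>x\<in>span A. \<theta> x \<in> span A \<and> \<rho> x \<in> span A \<and> \<theta> (\<theta> x) = 0 \<and> \<rho> (\<rho> x) = 0
        \<and> \<theta> (\<rho> x) + \<rho> (\<theta> x) = x"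
      using even_dim_anticommuting_nilpotents[OF fA A(1)] by blast
    then show ?thesis
      using c(1) unfolding A(2) T_def
      by (intro sum_of_three_idempotents_if_scalar[OF _ t, of c]) blast+
  qed
qed

end

theorem corollary1p7:
  fixes scale :: "'f::field \<Rightarrow> 'v::ab_group_add \<Rightarrow> 'v"
    and \<alpha> :: 'f and u :: "'v \<Rightarrow> 'v"
  assumes "CHAR('f) = 2"
    and "vector_space scale"
    and "infinite_dimensional scale"
    and "\<alpha> \<in> {0, 1}"
    and "finite_rank_endomorphism scale u"
    and "finite_rank_trace scale u \<in> {0, 1}"
  shows "\<exists>p q r. idempotent_endomorphism scale p
           \<and> idempotent_endomorphism scale q
           \<and> idempotent_endomorphism scale r
           \<and> (\<lambda>x. scale \<alpha> x + u x) = (\<lambda>x. p x + q x + r x)"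
proof -
  interpret char2_vector_space scale
    using assms(1,2) by (simp add: char2_vector_space_def char2_vector_space_axioms_def)
  obtain p q r where pqr: "idempotent_endomorphism scale p" "idempotent_endomorphism scale q"
      "idempotent_endomorphism scale r" and sum: "\<And>x. u x = p x + q x + r x"
    using finite_rank_sum_of_three_idempotents[OF assms(3,5,6)] by blast
  show ?thesis
  proof (cases "\<alpha> = 0")
    case True
    then have "(\<lambda>x. scale \<alpha> x + u x) = (\<lambda>x. p x + q x + r x)" by (simp add: sum)
    then show ?thesis using pqr by blast
  next
    case False
    then have "(\<lambda>x. scale \<alpha> x + u x) = (\<lambda>x. (x + p x) + q x + r x)"
      using assms(4) by (simp add: sum add.assoc)
    moreover have "idempotent_endomorphism scale (\<lambda>x. x + p x)"
    proof -
      have p: "endomorphism scale p" and pp: "p (p x) = p x" for x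
        using pqr(1) unfolding idempotent_endomorphism_def by (auto simp: fun_eq_iff)
      show ?thesis
        unfolding idempotent_endomorphism_def
        using endo_plus[OF endo_ident p] by (auto simp: fun_eq_iff endo_add[OF p] pp)
    qed
    ultimately show ?thesis using pqr by blast
  qed
qed

end
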